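(* Let $p,q\ge1$ be integers, let $A\in\mathrm{Aut}(D_{p,q})$, and suppose that there does not exist any projective line in $\mathbb P^{p+q-1}$ on which every point is fixed by $A$. Then $A$ has at most $p$ fixed points in $D_{p,q}$, at most $q$ fixed points in $\mathbb P^{p+q-1}\setminus\overline{D_{p,q}}$, and at most $\min\{2p,2q\}$ fixed points in $\partial D_{p,q}$.
   Context: $H_{p,q}=\begin{pmatrix}I_p&0\\0&-I_q\end{pmatrix}$ and $\cdot^H$ is the Hermitian (conjugate) transpose. The generalized ball is $D_{p,q}=\{[z]\in\mathbb P^{p+q-1}: z^HH_{p,q}z>0\}$, with boundary $\partial D_{p,q}=\{[z]: z^HH_{p,q}z=0\}$ and closure $\overline{D_{p,q}}=D_{p,q}\cup\partial D_{p,q}$. $\mathrm{Aut}(D_{p,q})$ is the group of biholomorphic automorphisms of $D_{p,q}$. It is known that every automorphism of $D_{p,q}$ is the restriction of a projective linear automorphism $[z]\mapsto[Az]$ of $\mathbb P^{p+q-1}$ with $A\in U(p,q)=\{A\in GL(p+q,\mathbb C):A^HH_{p,q}A=H_{p,q}\}$; the automorphism is also regarded as this map of $\mathbb P^{p+q-1}$, and fixed points outside $D_{p,q}$ are understood for it. *)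

theory Defs
  imports "HOL-Analysis.Analysis"
begin

section \<open>Complex projective space\<close>

text \<open>
  The points of the projective space of \<open>complex ^ 'n\<close> are the one-dimensional complex
  linear subspaces; \<open>vec.span\<close>, \<open>vec.subspace\<close> and \<open>vec.dim\<close> refer to the complex
  vector space structure given by \<open>(*s)\<close>, not to the underlying real one.
\<close>

definition pclass :: "complex ^ 'n \<Rightarrow> (complex ^ 'n) set" where
  "pclass z = vec.span {z}"

definition proj_space :: "(complex ^ 'n) set set" where
  "proj_space = {pclass z | z. z \<noteq> 0}"

definition proj_line :: "(complex ^ 'n) set set \<Rightarrow> bool" where
  "proj_line L \<longleftrightarrow>
     (\<exists>W. vec.subspace W \<and> vec.dim W = 2 \<and> L = {P \<in> proj_space. P \<subseteq> W})"

text \<open>The map \<open>[z] \<mapsto> [A z]\<close>, as the image of a line under \<open>A\<close>.\<close>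

definition proj_map ::
    "complex ^ 'n ^ 'n \<Rightarrow> (complex ^ 'n) set \<Rightarrow> (complex ^ 'n) set" where
  "proj_map A P = (*v) A ` P"

lemma proj_map_pclass: "proj_map A (pclass z) = pclass (A *v z)"
  unfolding proj_map_def pclass_def vec.span_singleton
  by (simp add: image_image vector_scalar_commute)


section \<open>Holomorphic maps on open subsets of projective space\<close>

definition complex_differentiable_at ::
    "(complex ^ 'm \<Rightarrow> complex ^ 'n) \<Rightarrow> complex ^ 'm \<Rightarrow> bool" where
  "complex_differentiable_at g x \<longleftrightarrow>
     (\<exists>g'. (g has_derivative g') (at x) \<and> (\<forall>c v. g' (c *s v) = c *s g' v))"

definition chart_dom :: "'n \<Rightarrow> (complex ^ 'n) set set" where
  "chart_dom k = {pclass z | z. z $ k \<noteq> 0}"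

text \<open>
  The affine chart sends \<open>[z]\<close> to \<open>z / z\<^sub>k\<close>.  Its \<open>k\<close>-th entry is kept (it is constantly \<open>1\<close>),
  so that no separate index type for the remaining coordinates is needed.  Accordingly the
  inverse chart ignores the \<open>k\<close>-th entry of its argument and uses \<open>1\<close> instead; being
  holomorphic in all entries of the argument is then the same as being holomorphic in the
  entries other than the \<open>k\<close>-th.
\<close>

definition chart :: "'n \<Rightarrow> (complex ^ 'n) set \<Rightarrow> complex ^ 'n" where
  "chart k P = (THE x. x \<in> P \<and> x $ k = 1)"

definition chart_inv :: "'n \<Rightarrow> complex ^ 'n \<Rightarrow> (complex ^ 'n) set" where
  "chart_inv k x = pclass (\<chi> i. if i = k then 1 else x $ i)"

definition proj_holomorphic_on ::
    "((complex ^ 'n) set \<Rightarrow> (complex ^ 'n) set) \<Rightarrow> (complex ^ 'n) set set \<Rightarrow> bool" where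
  "proj_holomorphic_on f S \<longleftrightarrow>
     (\<forall>P\<in>S. \<exists>k l U. P \<in> chart_dom k \<and> open U \<and> chart k P \<in> U \<and>
        (\<forall>x\<in>U. chart_inv k x \<in> S \<and> f (chart_inv k x) \<in> chart_dom l \<and>
           complex_differentiable_at (\<lambda>y. chart l (f (chart_inv k y))) x))"

definition biholomorphic_automorphisms ::
    "(complex ^ 'n) set set \<Rightarrow> ((complex ^ 'n) set \<Rightarrow> (complex ^ 'n) set) set" where
  "biholomorphic_automorphisms S =
     {f. bij_betw f S S \<and> proj_holomorphic_on f S \<and> proj_holomorphic_on (inv_into S f) S}"


section \<open>Generalized balls and the group \<open>U(p,q)\<close>\<close>

text \<open>
  The index type \<open>'p + 'q\<close> realizes the block decomposition of vectors of length \<open>p + q\<close>, where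
  \<open>p = CARD('p) \<ge> 1\<close> and \<open>q = CARD('q) \<ge> 1\<close> are arbitrary.
\<close>

definition Hpq :: "complex ^ ('p::finite + 'q::finite) ^ ('p + 'q)" where
  "Hpq = (\<chi> i j. if i = j then (case i of Inl _ \<Rightarrow> 1 | Inr _ \<Rightarrow> -1) else 0)"

definition hermitian_transpose :: "complex ^ 'n ^ 'm \<Rightarrow> complex ^ 'm ^ 'n" where
  "hermitian_transpose A = (\<chi> i j. cnj (A $ j $ i))"

definition Upq :: "(complex ^ ('p::finite + 'q::finite) ^ ('p + 'q)) set" where
  "Upq = {A. invertible A \<and> hermitian_transpose A ** Hpq ** A = Hpq}"

text \<open>The number \<open>z\<^sup>H H z\<close> is real because \<open>H\<close> is Hermitian, so taking \<open>Re\<close> loses nothing.\<close>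

definition hform :: "complex ^ ('p::finite + 'q::finite) \<Rightarrow> real" where
  "hform z = Re (\<Sum>i\<in>UNIV. cnj (z $ i) * (Hpq *v z) $ i)"

definition gball :: "(complex ^ ('p::finite + 'q::finite)) set set" where
  "gball = {pclass z | z. z \<noteq> 0 \<and> hform z > 0}"

definition gball_boundary :: "(complex ^ ('p::finite + 'q::finite)) set set" where
  "gball_boundary = {pclass z | z. z \<noteq> 0 \<and> hform z = 0}"

definition gball_closure :: "(complex ^ ('p::finite + 'q::finite)) set set" where
  "gball_closure = gball \<union> gball_boundary"

end

theory Submission
  imports Defs
begin

text \<open>
  A fixed point of \<open>[z] \<mapsto> [A z]\<close> is spanned by an eigenvector of \<open>A\<close>, and as no projective line is
  fixed pointwise, distinct fixed points have distinct eigenvalues.  Since \<open>A\<close> preserves the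
  Hermitian form, eigenvectors for \<open>\<lambda>\<close> and \<open>\<mu>\<close> are orthogonal unless \<open>cnj \<lambda> * \<mu> = 1\<close>.  The
  eigenvalues on the ball and on the complement of its closure are unimodular, so the
  eigenvectors there are pairwise orthogonal and span a definite subspace, whose dimension is at
  most \<open>p\<close> or \<open>q\<close>.  On the boundary, the eigenvectors with \<open>\<bar>\<lambda>\<bar> \<le> 1\<close> span an isotropic subspace, and so
  do those with \<open>\<bar>\<lambda>\<bar> \<ge> 1\<close>; each of these has dimension at most \<open>min p q\<close>.
\<close>

section \<open>The indefinite Hermitian form and its signature\<close>

definition herm :: "complex ^ ('p::finite + 'q::finite) \<Rightarrow> complex ^ ('p + 'q) \<Rightarrow> complex" where
  "herm x y = (\<Sum>i\<in>UNIV. cnj (x $ i) * (Hpq *v y) $ i)"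

lemma hform_herm: "hform z = Re (herm z z)"
  by (simp add: hform_def herm_def)

lemma Hpq_mult: "(Hpq *v z) $ i = (case i of Inl _ \<Rightarrow> z $ i | Inr _ \<Rightarrow> - z $ i)"
  by (cases i)
    (simp_all add: Hpq_def matrix_vector_mult_def if_distrib[of "\<lambda>x. x * _"] cong: if_cong)

lemma herm_sum_left: "herm (\<Sum>v\<in>t. c v *s v) y = (\<Sum>v\<in>t. cnj (c v) * herm v y)"
  unfolding herm_def
  by (simp add: sum_component sum_distrib_left sum_distrib_right mult.assoc) (rule sum.swap)

lemma herm_sum_right: "herm x (\<Sum>v\<in>t. c v *s v) = (\<Sum>v\<in>t. c v * herm x v)"
  unfolding herm_def vec.sum vec.scale
  by (simp add: sum_component sum_distrib_left mult.left_commute) (rule sum.swap)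

lemma herm_scale: "herm (c *s x) (d *s y) = cnj c * d * herm x y"
  unfolding herm_def vec.scale by (simp add: sum_distrib_left algebra_simps)

lemma hform_split:
  "hform z = (\<Sum>i\<in>UNIV. (norm (z $ Inl i))\<^sup>2) - (\<Sum>i\<in>UNIV. (norm (z $ Inr i))\<^sup>2)"
proof -
  have re: "Re (cnj c * c) = (norm c)\<^sup>2" for c :: complex
    by (metis Re_complex_of_real complex_norm_square mult.commute)
  have "hform z = (\<Sum>i\<in>UNIV. case i of Inl _ \<Rightarrow> (norm (z $ i))\<^sup>2 | Inr _ \<Rightarrow> - (norm (z $ i))\<^sup>2)"
    unfolding hform_def Re_sum
    by (intro sum.cong refl) (simp only: Hpq_mult mult_minus_right uminus_complex.sel re split: sum.split, simp)
  then show ?thesis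
    by (simp add: UNIV_Plus_UNIV[symmetric] sum.Plus sum_negf del: UNIV_Plus_UNIV)
qed

lemma sum_norm_eq_0D:
  fixes g :: "'i::finite \<Rightarrow> complex"
  assumes "(\<Sum>i\<in>UNIV. (norm (g i))\<^sup>2) \<le> 0"
  shows "g i = 0"
proof -
  have "(\<Sum>i\<in>UNIV. (norm (g i))\<^sup>2) = 0"
    using assms by (intro antisym sum_nonneg) auto
  then show ?thesis by (subst (asm) sum_nonneg_eq_0_iff) auto
qed

text \<open>Only the subtracted sum of \<open>hform_split\<close> survives, so the form is negative
  definite where the first block vanishes. Hence the first block determines the vectors of any
  subspace on which the form is nonnegative.\<close>

lemma hform_nonneg_Inl_zero:
  assumes "\<forall>i. z $ Inl i = 0" and "hform z \<ge> 0"
  shows "z = 0"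
proof -
  have "z $ Inr i = 0" for i
    using assms by (intro sum_norm_eq_0D[of "\<lambda>i. z $ Inr i"]) (simp add: hform_split)
  with assms show ?thesis
    by (metis (mono_tags) obj_sumE vec_eq_iff zero_index)
qed

lemma hform_nonpos_Inr_zero:
  assumes "\<forall>i. z $ Inr i = 0" and "hform z \<le> 0"
  shows "z = 0"
proof -
  have "z $ Inl i = 0" for i
    using assms by (intro sum_norm_eq_0D[of "\<lambda>i. z $ Inl i"]) (simp add: hform_split)
  with assms show ?thesis
    by (metis (mono_tags) obj_sumE vec_eq_iff zero_index)
qed

section \<open>Eigenvectors and eigenvalues of matrices in \<open>Upq\<close>\<close>

lemma herm_Upq:
  assumes "A \<in> Upq"
  shows "herm (A *v x) (A *v y) = herm x y"
proof -
  have adj: "(\<Sum>i\<in>UNIV. cnj ((A *v x) $ i) * u $ i)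
      = (\<Sum>i\<in>UNIV. cnj (x $ i) * (hermitian_transpose A *v u) $ i)" for u
    by (simp add: matrix_vector_mult_def hermitian_transpose_def sum_distrib_left
        sum_distrib_right mult_ac) (rule sum.swap)
  have "hermitian_transpose A *v (Hpq *v (A *v y)) = Hpq *v y"
    using assms by (simp add: Upq_def matrix_vector_mul_assoc matrix_mul_assoc)
  then show ?thesis
    unfolding herm_def adj by simp
qed

text \<open>Invariance of the form gives \<open>herm x y = cnj l * m * herm x y\<close>.\<close>

lemma herm_eigenvectors:
  assumes "A \<in> Upq" "A *v x = l *s x" "A *v y = m *s y" "cnj l * m \<noteq> 1"
  shows "herm x y = 0"
  using herm_Upq[OF assms(1), of x y] assms(4) unfolding assms(2,3) herm_scale by simp

lemma eigenvalue_unimodular: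
  assumes "A \<in> Upq" "A *v z = l *s z" "hform z \<noteq> 0"
  shows "norm l = 1"
proof -
  have "cnj l * l = 1"
    using herm_eigenvectors[OF assms(1,2,2)] assms(3) by (metis hform_herm zero_complex.sel(1))
  then have "norm l * norm l = 1"
    by (metis complex_mod_cnj norm_mult norm_one)
  then show ?thesis
    by (metis abs_norm_cancel abs_square_eq_1 power2_eq_square)
qed

text \<open>The inverse of a unimodular \<open>l\<close> is \<open>cnj l\<close>. Thus for
  unimodular eigenvalues the condition of \<open>herm_eigenvectors\<close> just says that they
  differ.\<close>

lemma cnj_mult_eq_1D:
  assumes "cnj l * m = 1" and "norm l = 1"
  shows "l = m"
proof -
  have "l * cnj l = 1"
    using assms(2) complex_norm_square[of l] by simp
  then have "m = l * (cnj l * m)"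
    by (metis mult.assoc mult_1)
  with assms(1) show ?thesis by simp
qed

section \<open>Linear independence and dimension bounds\<close>

lemma independent_eigenvectors:
  fixes A :: "'a::field ^ 'n ^ 'n"
  assumes "\<forall>v\<in>B. v \<noteq> 0 \<and> A *v v = l v *s v" and "inj_on l B"
  shows "vec.independent B"
proof -
  have "vec.independent S" if "finite S" "S \<subseteq> B" for S
    using that
  proof (induction S rule: finite_induct)
    case empty
    then show ?case by (simp add: vec.independent_empty)
  next
    case (insert v S)
    then have ind: "vec.independent S" by simp
    have "v \<notin> vec.span S"
    proof
      assume "v \<in> vec.span S"
      then obtain c where c: "v = (\<Sum>w\<in>S. c w *s w)"
        using vec.span_finite[OF insert.hyps(1)] by auto
      have "l v *s v = A *v v" using assms insert.prems by auto
      also have "\<dots> = (\<Sum>w\<in>S. c w *s (A *v w))"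
        by (subst c) (simp add: vec.sum vec.scale)
      also have "\<dots> = (\<Sum>w\<in>S. (c w * l w) *s w)"
        using assms insert.prems by (intro sum.cong) auto
      \<comment> \<open>The relation \<open>c\<close> multiplied by \<open>l v\<close> is subtracted
        from its image under \<open>A\<close>. This eliminates \<open>v\<close> and leaves a
        relation within the independent set \<open>S\<close>.\<close>
      finally have "(\<Sum>w\<in>S. (c w * (l w - l v)) *s w) = 0"
        by (subst (asm) c)
          (simp add: algebra_simps vec.scale_sum_right vec.scale_left_diff_distrib sum_subtractf)
      then have "c w * (l w - l v) = 0" if "w \<in> S" for w
        using vec.independentD[OF ind insert.hyps(1) order_refl, of "\<lambda>w. c w * (l w - l v)"] that by blast
      moreover have "l w \<noteq> l v" if "w \<in> S" for w
        using inj_onD[OF assms(2)] that insert.hyps insert.prems by blast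
      ultimately have "v = 0" by (subst c) (auto intro!: sum.neutral)
      with assms insert.prems show False by auto
    qed
    with ind show ?case by (rule vec.independent_insertI[rotated])
  qed
  then show ?thesis
    unfolding vec.independent_explicit_finite_subsets by blast
qed

text \<open>Reading off the coordinates \<open>e i\<close> is a linear map, injective on the span by
  the second assumption. It carries \<open>B\<close> to an independent set in a space of dimension
  \<open>CARD('m)\<close>.\<close>

lemma finite_card_of_coordinates:
  fixes B :: "('a::field ^ 'n) set" and e :: "'m::finite \<Rightarrow> 'n"
  assumes "vec.independent B"
    and "\<And>z. z \<in> vec.span B \<Longrightarrow> \<forall>i. z $ e i = 0 \<Longrightarrow> z = 0"
  shows "finite B \<and> card B \<le> CARD('m)"
proof -
  define \<pi> :: "'a ^ 'n \<Rightarrow> 'a ^ 'm" where "\<pi> z = (\<chi> i. z $ e i)" for z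
  interpret L: Vector_Spaces.linear "(*s)" "(*s)" \<pi>
    by unfold_locales (simp_all add: \<pi>_def vec_eq_iff)
  have inj: "inj_on \<pi> (vec.span B)"
    using assms(2) by (subst L.inj_on_iff_eq_0) (auto simp: \<pi>_def vec_eq_iff)
  then have "vec.independent (\<pi> ` B)"
    by (rule L.independent_injective_image[OF assms(1)])
  then have "card (\<pi> ` B) \<le> vec.dim (UNIV :: ('a ^ 'm) set)"
    by (intro vec.independent_card_le_dim) auto
  moreover have "card (\<pi> ` B) = card B"
    by (rule card_image) (meson inj inj_on_subset vec.span_superset)
  ultimately show ?thesis
    using vec.finiteI_independent[OF assms(1)] by (simp add: card_cart_basis)
qed

text \<open>The sign \<open>\<epsilon>\<close> and the coordinates \<open>e\<close> allow the form to be used with either signature.\<close>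

lemma finite_card_semidefinite:
  fixes B :: "(complex ^ ('p::finite + 'q::finite)) set" and e :: "'m::finite \<Rightarrow> 'p + 'q"
  assumes "vec.independent B"
    and orth: "\<And>v w. v \<in> B \<Longrightarrow> w \<in> B \<Longrightarrow> v \<noteq> w \<Longrightarrow> herm v w = 0"
    and sign: "\<And>v. v \<in> B \<Longrightarrow> 0 \<le> \<epsilon> * hform v"
    and def: "\<And>z. \<forall>i. z $ e i = 0 \<Longrightarrow> 0 \<le> \<epsilon> * hform z \<Longrightarrow> z = 0"
  shows "finite B \<and> card B \<le> CARD('m)"
  using assms(1)
proof (rule finite_card_of_coordinates)
  fix z assume "z \<in> vec.span B" and 0: "\<forall>i. z $ e i = 0"
  then obtain t c where t: "finite t" "t \<subseteq> B" and z: "z = (\<Sum>v\<in>t. c v *s v)"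
    unfolding vec.span_explicit by blast
  have "herm z z = (\<Sum>v\<in>t. \<Sum>w\<in>t. cnj (c v) * c w * herm v w)"
    unfolding z herm_sum_left herm_sum_right
    by (simp add: sum_distrib_left mult.assoc mult.left_commute) (rule sum.swap)
  \<comment> \<open>Orthogonality removes the off-diagonal terms, so \<open>hform z\<close> is a
    combination of the values on \<open>B\<close> with nonnegative weights.\<close>
  also have "\<dots> = (\<Sum>v\<in>t. \<Sum>w\<in>t. if v = w then cnj (c v) * c v * herm v v else 0)"
    using t(2) by (intro sum.cong refl) (auto simp: orth subset_iff)
  also have "\<dots> = (\<Sum>v\<in>t. of_real ((norm (c v))\<^sup>2) * herm v v)"
    using t(1) by (simp add: complex_norm_square mult.commute del: of_real_power)
  finally have "\<epsilon> * hform z = (\<Sum>v\<in>t. (norm (c v))\<^sup>2 * (\<epsilon> * hform v))"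
    by (simp add: hform_herm sum_distrib_left mult.left_commute del: of_real_power)
  also have "\<dots> \<ge> 0"
    using t(2) sign by (intro sum_nonneg mult_nonneg_nonneg[OF zero_le_power2]) auto
  finally show "z = 0"
    using def 0 by blast
qed

section \<open>Fixed points and fixed lines in projective space\<close>

lemma pclass_self: "z \<in> pclass z"
  by (simp add: pclass_def vec.span_base)

lemma pclass_subset_iff:
  assumes "vec.subspace W"
  shows "pclass z \<subseteq> W \<longleftrightarrow> z \<in> W"
  using assms pclass_self[of z] vec.span_minimal[of "{z}" W] by (auto simp: pclass_def)

lemma pclass_eqI:
  assumes "z \<in> pclass w" "z \<noteq> 0"
  shows "pclass z = pclass w"
proof -
  obtain c where c: "z = c *s w"
    using assms(1) by (auto simp: pclass_def vec.span_singleton)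
  with assms(2) have "w = inverse c *s z" by auto
  then have "w \<in> pclass z"
    unfolding pclass_def by (metis vec.span_base vec.span_scale singletonI)
  with assms(1) show ?thesis
    unfolding pclass_def by (intro subset_antisym vec.span_minimal) (auto simp: vec.subspace_span)
qed

lemma proj_map_fixedD:
  assumes "proj_map A (pclass z) = pclass z"
  shows "\<exists>l. A *v z = l *s z"
proof -
  have "A *v z \<in> pclass z"
    using assms pclass_self[of "A *v z"] by (simp add: proj_map_pclass)
  then show ?thesis by (auto simp: pclass_def vec.span_singleton)
qed

text \<open>Every vector of the plane spanned by \<open>x\<close> and \<open>y\<close> is scaled by
  \<open>l\<close>, and \<open>l\<close> being nonzero keeps its class from collapsing to the zero
  subspace. Contrapositively, without a pointwise fixed line distinct fixed points have distinct
  eigenvalues.\<close>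

lemma fixed_proj_line:
  assumes "A *v x = l *s x" "A *v y = l *s y" "x \<noteq> 0" "y \<noteq> 0" "l \<noteq> 0"
    and "pclass x \<noteq> pclass y"
  shows "\<exists>L. proj_line L \<and> (\<forall>P\<in>L. proj_map A P = P)"
proof -
  let ?W = "vec.span {x, y}"
  have xy: "x \<notin> vec.span {y}"
    using assms(3,6) pclass_eqI unfolding pclass_def by blast
  then have "x \<noteq> y" by (auto simp: vec.span_base)
  have "vec.independent {x, y}"
    using xy assms(4) by (intro vec.independent_insertI) (auto simp: vec.independent_empty)
  then have "vec.dim ?W = 2"
    using \<open>x \<noteq> y\<close> by (simp add: vec.dim_eq_card_independent)
  then have line: "proj_line {P \<in> proj_space. P \<subseteq> ?W}"
    unfolding proj_line_def by (blast intro: vec.subspace_span)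
  have "proj_map A P = P" if P: "P \<in> proj_space" "P \<subseteq> ?W" for P
  proof -
    obtain z where z: "P = pclass z" "z \<noteq> 0"
      using P(1) by (auto simp: proj_space_def)
    with P(2) have "z \<in> ?W" by (simp add: pclass_subset_iff)
    then obtain a b where "z = a *s x + b *s y"
      by (auto simp: vec.span_insert vec.span_singleton algebra_simps)
    then have "A *v z = l *s z"
      using assms(1,2) by (simp add: vec.add vec.scale vec.scale_right_distrib mult.commute)
    moreover have "pclass (l *s z) = pclass z"
      using z(2) \<open>l \<noteq> 0\<close> by (intro pclass_eqI) (auto simp: pclass_def vec.span_base vec.span_scale)
    ultimately show ?thesis by (simp add: z(1) proj_map_pclass)
  qed
  with line show ?thesis by blast
qed

section \<open>Counting fixed points\<close>

text \<open>
  The hypothesis on \<open>Q\<close> makes eigenvectors with distinct eigenvalues in \<open>Q\<close> orthogonal.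
\<close>

lemma finite_card_fixed_points:
  fixes A :: "complex ^ ('p::finite + 'q::finite) ^ ('p + 'q)" and e :: "'m::finite \<Rightarrow> 'p + 'q"
  assumes A: "A \<in> Upq"
    and noline: "\<not> (\<exists>L. proj_line L \<and> (\<forall>P\<in>L. proj_map A P = P))"
    and Q: "\<And>l m. Q l \<Longrightarrow> Q m \<Longrightarrow> cnj l * m = 1 \<Longrightarrow> l = m"
    and X: "\<And>P. P \<in> X \<Longrightarrow> \<exists>z l. P = pclass z \<and> z \<noteq> 0 \<and> A *v z = l *s z \<and> Q l \<and> 0 \<le> \<epsilon> * hform z"
    and def: "\<And>z. \<forall>i. z $ e i = 0 \<Longrightarrow> 0 \<le> \<epsilon> * hform z \<Longrightarrow> z = 0"
  shows "finite X \<and> card X \<le> CARD('m)"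
proof -
  obtain r k where r: "\<And>P. P \<in> X \<Longrightarrow> P = pclass (r P) \<and> r P \<noteq> 0 \<and> A *v r P = k P *s r P
      \<and> Q (k P) \<and> 0 \<le> \<epsilon> * hform (r P)"
    using X by metis
  have inj_r: "inj_on r X"
    by (rule inj_on_inverseI[of _ pclass]) (rule conjunct1[OF r, symmetric])
  \<comment> \<open>\<open>independent_eigenvectors\<close> expects the eigenvalue as a function of
    the vector; \<open>pclass\<close> recovers the point from its representative.\<close>
  define l where "l v = k (pclass v)" for v
  have l: "l (r P) = k P" if "P \<in> X" for P
    using r[OF that] unfolding l_def by argo
  have nz: "k P \<noteq> 0" if "P \<in> X" for P
  proof
    assume "k P = 0"
    then have "A *v r P = 0" using r[OF that] by simp
    moreover have "invertible A" using A by (simp add: Upq_def)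
    ultimately show False
      using r[OF that] by (metis inj_eq inj_matrix_vector_mult matrix_vector_mult_0_right)
  qed
  have inj_k: "k P \<noteq> k P'" if "P \<in> X" "P' \<in> X" "P \<noteq> P'" for P P'
    using fixed_proj_line[of A "r P" "k P" "r P'"] r[OF that(1)] r[OF that(2)] nz[OF that(1)] that(3) noline
    by metis
  have "finite (r ` X) \<and> card (r ` X) \<le> CARD('m)"
  proof (rule finite_card_semidefinite[where \<epsilon> = \<epsilon> and e = e])
    have "inj_on l (r ` X)"
    proof (rule inj_onI)
      fix v w assume "v \<in> r ` X" "w \<in> r ` X" "l v = l w"
      then obtain P P' where P: "P \<in> X" "P' \<in> X" "v = r P" "w = r P'" "k P = k P'"
        by (auto simp: l)
      then show "v = w"
        using inj_k[of P P'] by blast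
    qed
    moreover have "\<forall>v\<in>r ` X. v \<noteq> 0 \<and> A *v v = l v *s v"
      using conjunct2[OF r] by (simp add: l)
    ultimately show "vec.independent (r ` X)"
      by (rule independent_eigenvectors[rotated])
    show "herm v w = 0" if vw: "v \<in> r ` X" "w \<in> r ` X" "v \<noteq> w" for v w
    proof -
      obtain P P' where P: "P \<in> X" "P' \<in> X" "v = r P" "w = r P'" using vw by auto
      with vw have "P \<noteq> P'" by auto
      \<comment> \<open>Otherwise \<open>Q\<close> would force equal eigenvalues, which
        \<open>inj_k\<close> excludes.\<close>
      then have "cnj (k P) * k P' \<noteq> 1"
        using inj_k[OF P(1,2)] r[OF P(1)] r[OF P(2)] Q by metis
      then show ?thesis
        using herm_eigenvectors[OF A] r[OF P(1)] r[OF P(2)] P(3,4) by blast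
    qed
    show "0 \<le> \<epsilon> * hform v" if "v \<in> r ` X" for v
      using that conjunct2[OF r] by auto
  qed (rule def)
  then show ?thesis
    using inj_r by (simp add: finite_image_iff card_image)
qed

theorem corollary3p10:
  fixes f :: "(complex ^ ('p::finite + 'q::finite)) set \<Rightarrow> (complex ^ ('p + 'q)) set"
    and A :: "complex ^ ('p + 'q) ^ ('p + 'q)"
  assumes "f \<in> biholomorphic_automorphisms gball"
    and "A \<in> Upq"
    and "\<forall>P\<in>gball. f P = proj_map A P"
    and "\<not> (\<exists>L. proj_line L \<and> (\<forall>P\<in>L. proj_map A P = P))"
  shows "(finite {P \<in> gball. proj_map A P = P} \<and>
          card {P \<in> gball. proj_map A P = P} \<le> CARD('p)) \<and>
         (finite {P \<in> proj_space - gball_closure. proj_map A P = P} \<and>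
          card {P \<in> proj_space - gball_closure. proj_map A P = P} \<le> CARD('q)) \<and>
         (finite {P \<in> gball_boundary. proj_map A P = P} \<and>
          card {P \<in> gball_boundary. proj_map A P = P} \<le> min (2 * CARD('p)) (2 * CARD('q)))"
proof (intro conjI)
  \<comment> \<open>Sign \<open>1\<close> is paired with the first block and yields the bound
    \<open>CARD('p)\<close>; sign \<open>- 1\<close> is paired with the second block and yields
    \<open>CARD('q)\<close>.\<close>
  have def_p: "z = 0" if "\<forall>i :: 'p. z $ Inl i = 0" "0 \<le> 1 * hform z"
    for z :: "complex ^ ('p + 'q)"
    using that by (intro hform_nonneg_Inl_zero) simp_all
  note count_p = finite_card_fixed_points[OF assms(2,4) _ _ def_p, where \<epsilon> = 1]
  have def_q: "z = 0" if "\<forall>i :: 'q. z $ Inr i = 0" "0 \<le> - 1 * hform z"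
    for z :: "complex ^ ('p + 'q)"
    using that by (intro hform_nonpos_Inr_zero) simp_all
  note count_q = finite_card_fixed_points[OF assms(2,4) _ _ def_q, where \<epsilon> = "- 1"]
  let ?unit = "\<lambda>l :: complex. norm l = 1"
  have unit: "l = m" if "?unit l" "?unit m" "cnj l * m = 1" for l m
    using that cnj_mult_eq_1D by blast

  have "\<exists>z l. P = pclass z \<and> z \<noteq> 0 \<and> A *v z = l *s z \<and> ?unit l \<and> 0 \<le> 1 * hform z"
    if P: "P \<in> {P \<in> gball. proj_map A P = P}" for P
  proof -
    obtain z where z: "P = pclass z" "z \<noteq> 0" "hform z > 0"
      using P unfolding gball_def by blast
    with P obtain l where l: "A *v z = l *s z" using proj_map_fixedD by blast
    have "?unit l" using eigenvalue_unimodular[OF assms(2) l] z(3) by simp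
    with z l show ?thesis by (intro exI[of _ z] exI[of _ l]) simp
  qed
  from count_p[OF unit this] show
    "finite {P \<in> gball. proj_map A P = P}" "card {P \<in> gball. proj_map A P = P} \<le> CARD('p)"
    by blast+

  have "\<exists>z l. P = pclass z \<and> z \<noteq> 0 \<and> A *v z = l *s z \<and> ?unit l \<and> 0 \<le> - 1 * hform z"
    if P: "P \<in> {P \<in> proj_space - gball_closure. proj_map A P = P}" for P
  proof -
    obtain z where z: "P = pclass z" "z \<noteq> 0"
      using P unfolding proj_space_def by blast
    with P have neg: "hform z < 0"
      unfolding gball_closure_def gball_def gball_boundary_def
      using linorder_less_linear[of "hform z" 0] by blast
    from z P obtain l where l: "A *v z = l *s z" using proj_map_fixedD by blast
    have "?unit l" using eigenvalue_unimodular[OF assms(2) l] neg by simp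
    with z l neg show ?thesis by (intro exI[of _ z] exI[of _ l]) simp
  qed
  from count_q[OF unit this] show
    "finite {P \<in> proj_space - gball_closure. proj_map A P = P}"
    "card {P \<in> proj_space - gball_closure. proj_map A P = P} \<le> CARD('q)"
    by blast+

  \<comment> \<open>On null vectors both signs are admissible, so \<open>count_p\<close> and
    \<open>count_q\<close> both apply to \<open>?N Q\<close>.\<close>
  let ?N = "\<lambda>Q. {P. \<exists>z l. P = pclass z \<and> z \<noteq> 0 \<and> A *v z = l *s z \<and> Q l \<and> hform z = 0}"
  let ?le = "\<lambda>l :: complex. norm l \<le> 1" and ?ge = "\<lambda>l :: complex. norm l \<ge> 1"
  have norm_eq: "norm l * norm m = 1" if "cnj l * m = 1" for l m :: complex
    using that by (metis complex_mod_cnj norm_mult norm_one)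
  \<comment> \<open>Two norms with product 1 that are both at most 1, or both at least 1, must equal
    1; this reduces \<open>le\<close> and \<open>ge\<close> to the unimodular case.\<close>
  have le: "l = m" if "?le l" "?le m" "cnj l * m = 1" for l m
    using that norm_eq[OF that(3)] cnj_mult_eq_1D[OF that(3)] mult_left_le[of "norm m" "norm l"] by simp
  have ge: "l = m" if "?ge l" "?ge m" "cnj l * m = 1" for l m
    using that norm_eq[OF that(3)] cnj_mult_eq_1D[OF that(3)]
      mult_left_mono[of 1 "norm m" "norm l"] by simp
  have N: "finite (?N Q) \<and> card (?N Q) \<le> CARD('p) \<and> card (?N Q) \<le> CARD('q)"
    if "\<And>l m. Q l \<Longrightarrow> Q m \<Longrightarrow> cnj l * m = 1 \<Longrightarrow> l = m" for Q
  proof -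
    have "finite (?N Q) \<and> card (?N Q) \<le> CARD('p)"
      by (rule count_p[of Q]) (use that in auto)
    moreover have "finite (?N Q) \<and> card (?N Q) \<le> CARD('q)"
      by (rule count_q[of Q]) (use that in auto)
    ultimately show ?thesis by blast
  qed
  \<comment> \<open>The two classes overlap in the unimodular eigenvalues, which does no harm to an
    upper bound obtained from their union.\<close>
  have sub: "{P \<in> gball_boundary. proj_map A P = P} \<subseteq> ?N ?le \<union> ?N ?ge"
  proof
    fix P assume P: "P \<in> {P \<in> gball_boundary. proj_map A P = P}"
    then obtain z where z: "P = pclass z" "z \<noteq> 0" "hform z = 0"
      by (auto simp: gball_boundary_def)
    with P obtain l where "A *v z = l *s z" using proj_map_fixedD by blast
    with z show "P \<in> ?N ?le \<union> ?N ?ge" using linear[of "norm l" 1] by blast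
  qed
  have fin: "finite (?N ?le \<union> ?N ?ge)"
    using N[of ?le, OF le] N[of ?ge, OF ge] by blast
  with sub show "finite {P \<in> gball_boundary. proj_map A P = P}"
    by (rule finite_subset)
  \<comment> \<open>Each class has at most \<open>CARD('p)\<close> and at most
    \<open>CARD('q)\<close> points, whence the factor 2.\<close>
  have "card {P \<in> gball_boundary. proj_map A P = P} \<le> card (?N ?le) + card (?N ?ge)"
    using card_mono[OF fin sub] card_Un_le[of "?N ?le" "?N ?ge"] by linarith
  then show "card {P \<in> gball_boundary. proj_map A P = P} \<le> min (2 * CARD('p)) (2 * CARD('q))"
    using N[of ?le, OF le] N[of ?ge, OF ge] by linarith
qed

end
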